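(* Let $M$ be a matroid of rank $r$ having two nontrivial connected flats $X$ and $X'$ such that (1) $X\cap X'\neq\emptyset$, (2) $r(X\cup X')=r$, and (3) $X\cup X'$ is a proper subset of $E(M)$. Then $M$ is not a lattice path matroid.
   Context: Lattice paths start at $(0,0)$ and use steps $E=(1,0)$ and $N=(0,1)$. For lattice paths $P,Q$ from $(0,0)$ to $(m,r)$ with $P$ never going above $Q$, let $\mathcal{P}$ be the set of lattice paths from $(0,0)$ to $(m,r)$ going neither above $Q$ nor below $P$, and for $1\le i\le r$ let $N_i=\{j:\text{step } j \text{ is the } i\text{-th North step of some path in }\mathcal{P}\}$. $M[P,Q]$ is the transversal matroid on $[m+r]$ with presentation $(N_1,\ldots,N_r)$; a lattice path matroid is a matroid isomorphic to some $M[P,Q]$. A flat $X$ is connected if $M|X$ is connected, and nontrivial if $X$ is dependent. *)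

theory Defs
  imports Main
begin

section \<open>Finite matroids\<close>

text \<open>A matroid is given by its ground set and its predicate of independent sets.\<close>

locale matroid =
  fixes ground :: "'a set" and indep :: "'a set \<Rightarrow> bool"
  assumes finite_ground: "finite ground"
    and indep_ground: "indep I \<Longrightarrow> I \<subseteq> ground"
    and indep_empty: "indep {}"
    and indep_subset: "indep I \<Longrightarrow> J \<subseteq> I \<Longrightarrow> indep J"
    and indep_augment: "indep I \<Longrightarrow> indep J \<Longrightarrow> card I < card J \<Longrightarrow>
      \<exists>x\<in>J - I. indep (insert x I)"

definition matroid_rank :: "('a set \<Rightarrow> bool) \<Rightarrow> 'a set \<Rightarrow> nat" where
  "matroid_rank indep X = Max (card ` {I. I \<subseteq> X \<and> indep I})"

definition matroid_closure :: "'a set \<Rightarrow> ('a set \<Rightarrow> bool) \<Rightarrow> 'a set \<Rightarrow> 'a set" where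
  "matroid_closure ground indep X =
     {x \<in> ground. matroid_rank indep (insert x X) = matroid_rank indep X}"

definition flat :: "'a set \<Rightarrow> ('a set \<Rightarrow> bool) \<Rightarrow> 'a set \<Rightarrow> bool" where
  "flat ground indep X \<longleftrightarrow> X \<subseteq> ground \<and> matroid_closure ground indep X = X"

definition circuit :: "'a set \<Rightarrow> ('a set \<Rightarrow> bool) \<Rightarrow> 'a set \<Rightarrow> bool" where
  "circuit ground indep C \<longleftrightarrow> C \<subseteq> ground \<and> \<not> indep C \<and> (\<forall>D. D \<subset> C \<longrightarrow> indep D)"

definition connected_matroid :: "'a set \<Rightarrow> ('a set \<Rightarrow> bool) \<Rightarrow> bool" where
  "connected_matroid ground indep \<longleftrightarrow>
     (\<forall>x\<in>ground. \<forall>y\<in>ground. x \<noteq> y \<longrightarrow> (\<exists>C. circuit ground indep C \<and> x \<in> C \<and> y \<in> C))"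

text \<open>The independent sets of the restriction to \<open>X\<close>, whose ground set is \<open>X\<close>.\<close>

definition restrict_indep :: "('a set \<Rightarrow> bool) \<Rightarrow> 'a set \<Rightarrow> 'a set \<Rightarrow> bool" where
  "restrict_indep indep X I \<longleftrightarrow> I \<subseteq> X \<and> indep I"

definition connected_flat :: "'a set \<Rightarrow> ('a set \<Rightarrow> bool) \<Rightarrow> 'a set \<Rightarrow> bool" where
  "connected_flat ground indep X \<longleftrightarrow>
     flat ground indep X \<and> connected_matroid X (restrict_indep indep X)"

definition nontrivial_flat :: "'a set \<Rightarrow> ('a set \<Rightarrow> bool) \<Rightarrow> 'a set \<Rightarrow> bool" where
  "nontrivial_flat ground indep X \<longleftrightarrow> flat ground indep X \<and> \<not> indep X"

definition matroid_isomorphic ::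
  "'a set \<Rightarrow> ('a set \<Rightarrow> bool) \<Rightarrow> 'b set \<Rightarrow> ('b set \<Rightarrow> bool) \<Rightarrow> bool" where
  "matroid_isomorphic ground indep ground' indep' \<longleftrightarrow>
     (\<exists>f. bij_betw f ground ground' \<and> (\<forall>I. I \<subseteq> ground \<longrightarrow> (indep I \<longleftrightarrow> indep' (f ` I))))"

text \<open>
  The independent sets of the transversal matroid on \<open>S\<close> with presentation \<open>(A i)\<close>, \<open>i \<in> J\<close>,
  are the partial transversals of this family: an index in \<open>J\<close> may remain unused.
\<close>

definition transversal_indep ::
  "'a set \<Rightarrow> 'i set \<Rightarrow> ('i \<Rightarrow> 'a set) \<Rightarrow> 'a set \<Rightarrow> bool" where
  "transversal_indep S J A I \<longleftrightarrow>
     I \<subseteq> S \<and> (\<exists>\<phi>. inj_on \<phi> I \<and> (\<forall>x\<in>I. \<phi> x \<in> J \<and> x \<in> A (\<phi> x)))"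

section \<open>Lattice paths\<close>

datatype step = East | North

type_synonym lattice_path = "step list"

definition lattice_path_to :: "nat \<Rightarrow> nat \<Rightarrow> lattice_path \<Rightarrow> bool" where
  "lattice_path_to m r P \<longleftrightarrow> count_list P East = m \<and> count_list P North = r"

text \<open>The lattice points visited by a path starting at the origin.\<close>

definition path_points :: "lattice_path \<Rightarrow> (nat \<times> nat) set" where
  "path_points P =
     {(count_list (take k P) East, count_list (take k P) North) | k. k \<le> length P}"

text \<open>
  For paths with common end points every vertical line through a lattice point of one path meets
  the other one. A point is above (below) a path if it is strictly higher (lower) than all
  points of the path on its vertical line. It suffices to test lattice points.
\<close>

definition never_above :: "lattice_path \<Rightarrow> lattice_path \<Rightarrow> bool" where
  "never_above P Q \<longleftrightarrow> (\<forall>(x, y)\<in>path_points P. \<exists>y'. (x, y') \<in> path_points Q \<and> y \<le> y')"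

definition never_below :: "lattice_path \<Rightarrow> lattice_path \<Rightarrow> bool" where
  "never_below P Q \<longleftrightarrow> (\<forall>(x, y)\<in>path_points P. \<exists>y'. (x, y') \<in> path_points Q \<and> y' \<le> y)"

definition paths_between ::
  "nat \<Rightarrow> nat \<Rightarrow> lattice_path \<Rightarrow> lattice_path \<Rightarrow> lattice_path set" where
  "paths_between m r P Q = {R. lattice_path_to m r R \<and> never_above R Q \<and> never_below R P}"

text \<open>Steps are numbered from \<open>1\<close>.\<close>

definition is_ith_North_step :: "nat \<Rightarrow> nat \<Rightarrow> lattice_path \<Rightarrow> bool" where
  "is_ith_North_step i j R \<longleftrightarrow>
     1 \<le> j \<and> j \<le> length R \<and> R ! (j - 1) = North \<and> count_list (take j R) North = i"

definition North_set :: "nat \<Rightarrow> nat \<Rightarrow> lattice_path \<Rightarrow> lattice_path \<Rightarrow> nat \<Rightarrow> nat set" where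
  "North_set m r P Q i = {j. \<exists>R\<in>paths_between m r P Q. is_ith_North_step i j R}"

text \<open>The independent sets of \<open>M[P,Q]\<close>, whose ground set is \<open>{1..m + r}\<close>.\<close>

definition path_indep :: "nat \<Rightarrow> nat \<Rightarrow> lattice_path \<Rightarrow> lattice_path \<Rightarrow> nat set \<Rightarrow> bool" where
  "path_indep m r P Q = transversal_indep {1..m + r} {1..r} (North_set m r P Q)"

definition lattice_path_matroid :: "'a set \<Rightarrow> ('a set \<Rightarrow> bool) \<Rightarrow> bool" where
  "lattice_path_matroid ground indep \<longleftrightarrow>
     (\<exists>m r P Q. lattice_path_to m r P \<and> lattice_path_to m r Q \<and> never_above P Q \<and>
        matroid_isomorphic ground indep {1..m + r} (path_indep m r P Q))"

end

theory Submission
  imports Defs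
begin

text \<open>
  In \<open>M[P,Q]\<close> an element \<open>x\<close> lies in \<open>N\<^sub>i\<close> exactly for the \<open>i\<close> in an interval \<open>N(x)\<close>, both ends
  of which are monotone in \<open>x\<close>. By Hall's theorem a dependent connected set \<open>X\<close> has rank
  \<open>|N(X)|\<close>, so a connected nontrivial flat consists of all \<open>e\<close> with \<open>N(e) \<subseteq> N(X)\<close>; connectedness
  makes \<open>N(X)\<close> an interval. If \<open>X \<union> X'\<close> has full rank, then \<open>N(X) \<union> N(X')\<close> contains every index.
  For \<open>e \<notin> X \<union> X'\<close> there are \<open>p \<in> N(e) - N(X)\<close> and \<open>q \<in> N(e) - N(X')\<close>, whence \<open>p \<in> N(X')\<close> and
  \<open>q \<in> N(X)\<close>. Taking \<open>j \<in> N(x)\<close> with \<open>x \<in> X \<inter> X'\<close>, monotonicity puts \<open>p\<close> and \<open>q\<close> on the same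
  side of \<open>j \<in> N(X) \<inter> N(X')\<close>, contradicting that \<open>N(X)\<close> and \<open>N(X')\<close> are intervals.
\<close>

section \<open>Matchings and Hall's theorem\<close>

text \<open>Induction on the total size of the sets \<open>N x\<close>. As long as some
  \<open>N x\<close> has two elements, one of them can be deleted without violating Hall's
  condition; once all are singletons, the condition for pairs is injectivity.\<close>

lemma hall_marriage:
  fixes N :: "'a \<Rightarrow> 'i set"
  assumes "finite I" and "\<And>x. x \<in> I \<Longrightarrow> finite (N x)"
    and "\<And>Z. Z \<subseteq> I \<Longrightarrow> card Z \<le> card (\<Union> (N ` Z))"
  shows "\<exists>\<phi>. inj_on \<phi> I \<and> (\<forall>x\<in>I. \<phi> x \<in> N x)"
  using assms(2,3)
proof (induction "\<Sum>x\<in>I. card (N x)" arbitrary: N rule: less_induct)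
  case less
  note fin = less.prems(1) and hall = less.prems(2)
  have fin_Un: "finite (\<Union> (N ` Z))" if "Z \<subseteq> I" for Z
    using that fin finite_subset[OF that \<open>finite I\<close>] by blast
  have nonempty: "N x \<noteq> {}" if "x \<in> I" for x
    using hall[of "{x}"] that by auto
  show ?case
  proof (cases "\<forall>x\<in>I. card (N x) = 1")
    case True
    then have "\<forall>x\<in>I. \<exists>i. N x = {i}" by (simp add: card_1_singleton_iff)
    then obtain \<phi> where \<phi>: "\<And>x. x \<in> I \<Longrightarrow> N x = {\<phi> x}" by metis
    have "inj_on \<phi> I"
    proof (rule inj_onI, rule ccontr)
      fix x y assume "x \<in> I" "y \<in> I" "\<phi> x = \<phi> y" "x \<noteq> y"
      then show False using hall[of "{x, y}"] by (simp add: \<phi>)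
    qed
    then show ?thesis using \<phi> by blast
  next
    case False
    then obtain x where x: "x \<in> I" "card (N x) \<noteq> 1" by blast
    then obtain i j where ij: "i \<in> N x" "j \<in> N x" "i \<noteq> j"
      using nonempty[OF x(1)] by (metis all_not_in_conv is_singletonI' is_singleton_altdef)
    define del where "del k = N(x := N x - {k})" for k
    \<comment> \<open>If deleting \<open>i\<close> and deleting \<open>j\<close> both violate Hall's condition, submodularity of
      \<open>Z \<mapsto> card (\<Union> (N ` Z))\<close> produces a violation for \<open>N\<close> itself.\<close>
    have "\<exists>k\<in>{i, j}. \<forall>Z. Z \<subseteq> I \<longrightarrow> card Z \<le> card (\<Union> (del k ` Z))"
    proof (rule ccontr)
      assume "\<not> ?thesis"
      then obtain Y Z where YZ: "Y \<subseteq> I" "card (\<Union> (del i ` Y)) < card Y"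
          "Z \<subseteq> I" "card (\<Union> (del j ` Z)) < card Z"
        by (meson insertI1 insertI2 not_le)
      \<comment> \<open>Deletion changes only the set at \<open>x\<close>, so a violating set must
        contain \<open>x\<close>.\<close>
      have xin: "x \<in> Y" "x \<in> Z"
        using YZ hall[of Y] hall[of Z] unfolding del_def
        by (metis (no_types, lifting) fun_upd_apply image_cong not_le)+
      have finYZ: "finite Y" "finite Z" using YZ \<open>finite I\<close> finite_subset by auto
      let ?U = "\<Union> (del i ` Y)" and ?V = "\<Union> (del j ` Z)"
      have finUV: "finite ?U" "finite ?V"
        using fin_Un[OF YZ(1)] fin_Un[OF YZ(3)]
        by (auto simp: del_def intro: rev_finite_subset split: if_splits)
      have "\<Union> (N ` (Y \<union> Z)) \<subseteq> ?U \<union> ?V"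
        using xin ij by (auto simp: del_def)
      then have "card (Y \<union> Z) \<le> card (?U \<union> ?V)"
        using hall[of "Y \<union> Z"] YZ finUV by (meson card_mono finite_UnI le_sup_iff le_trans)
      \<comment> \<open>Leaving out \<open>x\<close> costs one element, less than the slack of two
        that the strict inequalities for \<open>Y\<close> and \<open>Z\<close> provide.\<close>
      moreover have "\<Union> (N ` (Y \<inter> Z - {x})) \<subseteq> ?U \<inter> ?V"
        by (auto simp: del_def)
      then have "card (Y \<inter> Z - {x}) \<le> card (?U \<inter> ?V)"
        using hall[of "Y \<inter> Z - {x}"] YZ finUV
        by (meson Diff_subset card_mono finite_Int inf_le1 le_trans subset_trans)
      then have "card (Y \<inter> Z) \<le> card (?U \<inter> ?V) + 1"
        using xin finYZ by simp
      ultimately show False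
        using card_Un_Int[OF finUV] card_Un_Int[OF finYZ] YZ by linarith
    qed
    then obtain k where k: "k \<in> {i, j}" "\<And>Z. Z \<subseteq> I \<Longrightarrow> card Z \<le> card (\<Union> (del k ` Z))" by blast
    have "(\<Sum>y\<in>I. card (del k y)) < (\<Sum>y\<in>I. card (N y))"
    proof (rule sum_strict_mono_ex1[OF \<open>finite I\<close>])
      show "\<forall>y\<in>I. card (del k y) \<le> card (N y)"
        using fin by (auto simp: del_def intro: card_mono)
      show "\<exists>y\<in>I. card (del k y) < card (N y)"
        using fin x k ij
        by (intro bexI[of _ x])
          (auto simp: del_def intro: card_Diff1_less simp del: card_Diff_singleton)
    qed
    moreover have "finite (del k y)" if "y \<in> I" for y
      using fin[OF that] fin[OF x(1)] by (simp add: del_def)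
    ultimately obtain \<phi> where "inj_on \<phi> I" "\<forall>y\<in>I. \<phi> y \<in> del k y"
      using less.hyps k(2) by blast
    then show ?thesis by (intro exI[of _ \<phi>]) (auto simp: del_def split: if_splits)
  qed
qed

section \<open>Transversal matroids\<close>

text \<open>A transversal matroid in terms of the sets \<open>N x\<close> of indices of the presentation sets that
  contain the element \<open>x\<close>.\<close>

locale transversal =
  fixes ground :: "'a set" and indep :: "'a set \<Rightarrow> bool" and N :: "'a \<Rightarrow> 'i set"
  assumes finite_ground: "finite ground"
    and finite_N: "x \<in> ground \<Longrightarrow> finite (N x)"
    and indep_iff: "indep I \<longleftrightarrow> I \<subseteq> ground \<and> (\<exists>\<phi>. inj_on \<phi> I \<and> (\<forall>x\<in>I. \<phi> x \<in> N x))"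
begin

abbreviation nbr :: "'a set \<Rightarrow> 'i set" where
  "nbr X \<equiv> \<Union> (N ` X)"

text \<open>The matching runs from the indices to the elements: every index met by \<open>X\<close>
  gets its own representative in \<open>X\<close>. Inside the ground set this is the equality case
  of \<open>rank_le\<close>, in a form that can be glued.\<close>

definition saturated :: "'a set \<Rightarrow> bool" where
  "saturated X \<longleftrightarrow> (\<exists>g. inj_on g (nbr X) \<and> (\<forall>i\<in>nbr X. g i \<in> X \<and> i \<in> N (g i)))"

lemma finite_nbr: "X \<subseteq> ground \<Longrightarrow> finite (nbr X)"
  using finite_N by (intro finite_UN_I finite_subset[OF _ finite_ground]) auto

lemma card_indep_le:
  assumes "indep I" "I \<subseteq> X" "X \<subseteq> ground"
  shows "card I \<le> card (nbr X)"
proof -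
  obtain \<phi> where "inj_on \<phi> I" "\<forall>x\<in>I. \<phi> x \<in> N x" using assms(1) indep_iff by blast
  moreover have "\<phi> ` I \<subseteq> nbr X" using calculation assms(2) by blast
  ultimately show ?thesis using finite_nbr[OF assms(3)] card_inj_on_le by blast
qed

lemma finite_indep_subsets: "X \<subseteq> ground \<Longrightarrow> finite {I. I \<subseteq> X \<and> indep I}"
  using finite_subset[OF _ finite_ground] by simp

lemma rank_le:
  assumes "X \<subseteq> ground"
  shows "matroid_rank indep X \<le> card (nbr X)"
proof -
  have "indep {}" by (simp add: indep_iff)
  then show ?thesis
    unfolding matroid_rank_def using finite_indep_subsets[OF assms] card_indep_le assms
    by (subst Max_le_iff) auto
qed

lemma rank_ge:
  assumes "indep I" "I \<subseteq> X" "X \<subseteq> ground"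
  shows "card I \<le> matroid_rank indep X"
  unfolding matroid_rank_def using finite_indep_subsets[OF assms(3)] assms by (intro Max_ge) auto

lemma saturated_rank:
  assumes "X \<subseteq> ground" "saturated X"
  shows "matroid_rank indep X = card (nbr X)"
proof (rule antisym[OF rank_le[OF assms(1)]])
  obtain g where g: "inj_on g (nbr X)" "\<forall>i\<in>nbr X. g i \<in> X \<and> i \<in> N (g i)"
    using assms(2) saturated_def by auto
  have "indep (g ` nbr X)"
    unfolding indep_iff
  proof (intro conjI exI)
    show "g ` nbr X \<subseteq> ground" using g assms by blast
    show "inj_on (inv_into (nbr X) g) (g ` nbr X)" by (rule inj_on_inv_into) simp
    show "\<forall>x\<in>g ` nbr X. inv_into (nbr X) g x \<in> N x"
      using g by (metis f_inv_into_f inv_into_into)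
  qed
  then have "card (g ` nbr X) \<le> matroid_rank indep X"
    using g assms by (intro rank_ge) auto
  then show "card (nbr X) \<le> matroid_rank indep X" using card_image[OF g(1)] by simp
qed

text \<open>Keep \<open>g\<close> on \<open>nbr X\<close> and use \<open>h\<close> on the remaining
  indices. The two do not collide, for a representative in \<open>X\<close> would put its index into
  \<open>nbr X\<close>.\<close>

lemma saturated_Un:
  assumes "saturated X" "saturated Y"
  shows "saturated (X \<union> Y)"
proof -
  obtain g h where g: "inj_on g (nbr X)" "\<And>i. i \<in> nbr X \<Longrightarrow> g i \<in> X \<and> i \<in> N (g i)"
    and h: "inj_on h (nbr Y)" "\<And>i. i \<in> nbr Y \<Longrightarrow> h i \<in> Y \<and> i \<in> N (h i)"
    using assms unfolding saturated_def by metis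
  let ?k = "\<lambda>i. if i \<in> nbr X then g i else h i"
  have eq: "nbr (X \<union> Y) = nbr X \<union> nbr Y" by blast
  have sep: "g i \<noteq> h j" if "i \<in> nbr X" "j \<in> nbr Y" "j \<notin> nbr X" for i j
    using that g(2)[of i] h(2)[of j] by auto
  have inj: "i = j" if "i \<in> nbr X \<or> i \<in> nbr Y" "j \<in> nbr X \<or> j \<in> nbr Y" "?k i = ?k j" for i j
    using that sep g(1) h(1) unfolding inj_on_def by (metis (full_types))
  have "inj_on ?k (nbr (X \<union> Y))"
    unfolding eq by (rule inj_onI) (rule inj, simp_all del: UN_iff)
  moreover have "?k i \<in> X \<union> Y \<and> i \<in> N (?k i)" if "i \<in> nbr (X \<union> Y)" for i
    using that g(2)[of i] h(2)[of i] unfolding eq by (auto simp del: UN_iff)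
  ultimately show ?thesis unfolding saturated_def by blast
qed

lemma saturated_Union:
  assumes "finite \<C>" "\<And>C. C \<in> \<C> \<Longrightarrow> saturated C"
  shows "saturated (\<Union>\<C>)"
  using assms
proof (induction \<C> rule: finite_induct)
  case empty
  then show ?case by (simp add: saturated_def)
next
  case (insert C \<C>)
  then show ?case using saturated_Un[of C "\<Union>\<C>"] by simp
qed

text \<open>By minimality a circuit is itself the set violating Hall's condition; deleting one element
  leaves a matching that then has to use every index of the circuit.\<close>

lemma saturated_minimal_dependent:
  assumes "C \<subseteq> ground" "\<not> indep C" "\<And>D. D \<subset> C \<Longrightarrow> indep D"
  shows "saturated C"
proof -
  have finC: "finite C" using assms(1) finite_ground finite_subset by blast
  obtain Z where Z: "Z \<subseteq> C" "card (nbr Z) < card Z"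
    using hall_marriage[OF finC, of N] assms(1,2) finite_N indep_iff by (meson not_le subsetD)
  have "Z = C"
  proof (rule ccontr)
    assume "Z \<noteq> C"
    then have "indep Z" using assms(3) Z by blast
    then show False using card_indep_le[of Z Z] Z assms(1) by auto
  qed
  then have less: "card (nbr C) < card C" using Z by simp
  then obtain c where c: "c \<in> C" by fastforce
  then have "indep (C - {c})" using assms(3) by blast
  then obtain \<phi> where \<phi>: "inj_on \<phi> (C - {c})" "\<forall>x\<in>C - {c}. \<phi> x \<in> N x"
    unfolding indep_iff by blast
  have sub: "\<phi> ` (C - {c}) \<subseteq> nbr C" using \<phi>(2) by blast
  have "card (\<phi> ` (C - {c})) = card C - 1" using card_image[OF \<phi>(1)] c by simp
  then have onto: "\<phi> ` (C - {c}) = nbr C"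
    using card_seteq[OF finite_nbr[OF assms(1)] sub] less by simp
  show ?thesis
    unfolding saturated_def
  proof (intro exI conjI ballI)
    show "inj_on (inv_into (C - {c}) \<phi>) (nbr C)"
      using onto by (intro inj_on_inv_into) simp
    fix i assume "i \<in> nbr C"
    then have i: "i \<in> \<phi> ` (C - {c})" using onto by simp
    then show "inv_into (C - {c}) \<phi> i \<in> C" by (metis DiffD1 inv_into_into)
    show "i \<in> N (inv_into (C - {c}) \<phi> i)"
      using i \<phi>(2) by (metis f_inv_into_f inv_into_into)
  qed
qed

section \<open>Connected sets and saturation\<close>

lemma connected_circuitE:
  assumes "connected_matroid X (restrict_indep indep X)" "x \<in> X" "y \<in> X" "x \<noteq> y"
  obtains C where "C \<subseteq> X" "\<not> indep C" "\<And>D. D \<subset> C \<Longrightarrow> indep D" "x \<in> C" "y \<in> C"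
proof -
  obtain C where C: "circuit X (restrict_indep indep X) C" "x \<in> C" "y \<in> C"
    using assms unfolding connected_matroid_def by blast
  then show thesis
    using that[of C] unfolding circuit_def restrict_indep_def by blast
qed

text \<open>\<open>X\<close> is a union of circuits, each of them saturated. A singleton has no pair
  of elements to supply a circuit; there dependence makes \<open>X\<close> itself one.\<close>

lemma connected_imp_saturated:
  assumes "X \<subseteq> ground" "connected_matroid X (restrict_indep indep X)" "\<not> indep X"
  shows "saturated X"
proof -
  have "\<exists>C. C \<subseteq> X \<and> x \<in> C \<and> saturated C" if x: "x \<in> X" for x
  proof (cases "X = {x}")
    case True
    have "indep {}" by (simp add: indep_iff)
    then have "\<And>D. D \<subset> X \<Longrightarrow> indep D" using True by (metis subset_singletonD psubset_eq)
    then show ?thesis using saturated_minimal_dependent[OF assms(1,3)] x by blast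
  next
    case False
    then obtain y where "y \<in> X" "x \<noteq> y" using x by blast
    then obtain C where "C \<subseteq> X" "\<not> indep C" "\<And>D. D \<subset> C \<Longrightarrow> indep D" "x \<in> C"
      using connected_circuitE[OF assms(2) x] by metis
    then show ?thesis using saturated_minimal_dependent[of C] assms(1) by blast
  qed
  then have "\<Union> {C. C \<subseteq> X \<and> saturated C} = X" by blast
  moreover have "finite {C. C \<subseteq> X \<and> saturated C}"
    using finite_subset[OF assms(1) finite_ground] by simp
  then have "saturated (\<Union> {C. C \<subseteq> X \<and> saturated C})"
    by (rule saturated_Union) simp
  ultimately show ?thesis by (rule subst)
qed

text \<open>Adding \<open>e\<close> enlarges neither the neighbourhood nor, by saturation, the rank,
  so \<open>e\<close> is in the closure.\<close>

lemma saturated_flat_memI: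
  assumes "flat ground indep X" "saturated X" "e \<in> ground" "N e \<subseteq> nbr X"
  shows "e \<in> X"
proof -
  have X: "X \<subseteq> ground" "matroid_closure ground indep X = X"
    using assms(1) unfolding flat_def by auto
  have ins: "insert e X \<subseteq> ground" using X assms(3) by simp
  have sat: "saturated (insert e X)"
    using assms(2,4) unfolding saturated_def by (simp add: sup.absorb2) blast
  have "matroid_rank indep (insert e X) = matroid_rank indep X"
    using saturated_rank[OF ins sat] saturated_rank[OF X(1) assms(2)] assms(4)
    by (simp add: sup.absorb2)
  then show ?thesis using X(2) assms(3) unfolding matroid_closure_def by blast
qed

text \<open>A circuit through \<open>x\<close> and a second element would make \<open>{x}\<close>
  independent. This excludes loops from the intersection of two distinct connected flats.\<close>

lemma connected_loop:
  assumes "connected_matroid X (restrict_indep indep X)" "x \<in> X" "N x = {}"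
  shows "X = {x}"
proof (rule ccontr)
  assume "X \<noteq> {x}"
  then obtain y where "y \<in> X" "x \<noteq> y" using assms(2) by blast
  then obtain C where C: "\<And>D. D \<subset> C \<Longrightarrow> indep D" "x \<in> C" "y \<in> C"
    using connected_circuitE[OF assms(1,2)] by metis
  then have "indep {x}" using \<open>x \<noteq> y\<close> by (intro C(1)) blast
  then show False using assms(3) indep_iff by simp
qed

text \<open>If the two parts of a circuit have disjoint neighbourhoods, their matchings can be glued.\<close>

lemma connected_not_separated:
  assumes "X \<subseteq> ground" "connected_matroid X (restrict_indep indep X)"
    and "X = Y \<union> Z" "nbr Y \<inter> nbr Z = {}" "Y \<inter> Z = {}"
  shows "Y = {} \<or> Z = {}"
proof (rule ccontr)
  assume "\<not> ?thesis"
  then obtain y z where yz: "y \<in> Y" "z \<in> Z" by blast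
  then have "y \<in> X" "z \<in> X" "y \<noteq> z" using assms(3,5) by auto
  then obtain C where C: "C \<subseteq> X" "\<not> indep C" "\<And>D. D \<subset> C \<Longrightarrow> indep D" "y \<in> C" "z \<in> C"
    using connected_circuitE[OF assms(2)] by metis
  have "C \<inter> Y \<subset> C" "C \<inter> Z \<subset> C" using yz C assms(5) by auto
  then have "indep (C \<inter> Y)" "indep (C \<inter> Z)" using C(3) by auto
  then obtain \<phi> \<psi> where \<phi>: "inj_on \<phi> (C \<inter> Y)" "\<And>x. x \<in> C \<inter> Y \<Longrightarrow> \<phi> x \<in> N x"
    and \<psi>: "inj_on \<psi> (C \<inter> Z)" "\<And>x. x \<in> C \<inter> Z \<Longrightarrow> \<psi> x \<in> N x"
    unfolding indep_iff by blast
  let ?\<chi> = "\<lambda>x. if x \<in> Y then \<phi> x else \<psi> x"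
  have CYZ: "C \<subseteq> Y \<union> Z" using C(1) assms(3) by simp
  have sep: "\<phi> u \<noteq> \<psi> v" if "u \<in> C \<inter> Y" "v \<in> C \<inter> Z" for u v
  proof -
    have "\<phi> u \<in> nbr Y" "\<psi> v \<in> nbr Z" using \<phi>(2)[OF that(1)] \<psi>(2)[OF that(2)] that by blast+
    then show ?thesis using assms(4) by (metis disjoint_iff)
  qed
  have "inj_on ?\<chi> C"
  proof (rule inj_onI)
    fix u v assume uv: "u \<in> C" "v \<in> C" "?\<chi> u = ?\<chi> v"
    then show "u = v"
      using sep[of u v] sep[of v u] inj_onD[OF \<phi>(1), of u v] inj_onD[OF \<psi>(1), of u v] CYZ
      by (cases "u \<in> Y"; cases "v \<in> Y") auto
  qed
  moreover have "\<forall>x\<in>C. ?\<chi> x \<in> N x" using \<phi>(2) \<psi>(2) CYZ by auto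
  ultimately have "indep C" unfolding indep_iff using C(1) assms(1) by blast
  then show False using C(2) by contradiction
qed

end

section \<open>Transversal matroids presented by intervals\<close>

text \<open>For lattice paths, \<open>lo\<close> will be the height of the lower path before a step
  and \<open>hi\<close> that of the upper path after it. \<open>comparable\<close> expresses that
  both ends move in the same direction, without ordering the ground set.\<close>

locale interval_transversal = transversal ground indep "\<lambda>x. {lo x<..hi x}"
  for ground :: "'a set" and indep and lo hi :: "'a \<Rightarrow> nat" +
  fixes r :: nat
  assumes hi_le: "x \<in> ground \<Longrightarrow> hi x \<le> r"
    and comparable: "x \<in> ground \<Longrightarrow> y \<in> ground \<Longrightarrow>
      lo x \<le> lo y \<and> hi x \<le> hi y \<or> lo y \<le> lo x \<and> hi y \<le> hi x"
    and rank_ground: "matroid_rank indep ground = r"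
begin

text \<open>If \<open>j\<close> is missing, each interval lies wholly below or wholly above
  \<open>j\<close>, which splits \<open>X\<close> into parts with disjoint neighbourhoods. The
  intervals through \<open>i\<close> and \<open>k\<close> show that both parts are
  inhabited.\<close>

lemma nbr_convex:
  assumes "X \<subseteq> ground" "connected_matroid X (restrict_indep indep X)"
    and "i \<in> nbr X" "k \<in> nbr X" "i \<le> j" "j \<le> k"
  shows "j \<in> nbr X"
proof (rule ccontr)
  assume j: "j \<notin> nbr X"
  let ?Y = "{x \<in> X. hi x < j}" and ?Z = "{x \<in> X. \<not> hi x < j}"
  have "\<And>x. x \<in> ?Z \<Longrightarrow> j \<le> lo x" using j by force
  then have "nbr ?Y \<inter> nbr ?Z = {}" by fastforce
  then have "?Y = {} \<or> ?Z = {}"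
    using connected_not_separated[OF assms(1,2), of ?Y ?Z] by blast
  moreover obtain x z where "x \<in> X" "lo x < i" "z \<in> X" "k \<le> hi z"
    using assms(3,4) by auto
  then have "x \<in> ?Y" "z \<in> ?Z" using j assms(5,6) by force+
  ultimately show False by blast
qed

lemma nbr_subset:
  assumes "X \<subseteq> ground"
  shows "nbr X \<subseteq> {1..r}"
proof
  fix i assume "i \<in> nbr X"
  then obtain x where x: "x \<in> X" "lo x < i" "i \<le> hi x" by auto
  then show "i \<in> {1..r}" using hi_le[of x] assms by auto
qed

lemma spanning_nbr:
  assumes "Y \<subseteq> ground" "matroid_rank indep Y = r"
  shows "nbr Y = {1..r}"
  using rank_le[OF assms(1)] assms(2) card_seteq[OF _ nbr_subset[OF assms(1)]] by simp

theorem no_two_connected_flats: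
  assumes "X \<noteq> X'"
    and "nontrivial_flat ground indep X" "connected_flat ground indep X"
    and "nontrivial_flat ground indep X'" "connected_flat ground indep X'"
    and "X \<inter> X' \<noteq> {}"
    and "matroid_rank indep (X \<union> X') = r"
    and "X \<union> X' \<subset> ground"
  shows False
proof -
  have sub: "X \<subseteq> ground" "X' \<subseteq> ground" using assms(8) by auto
  have flat: "flat ground indep X" "flat ground indep X'"
    and dep: "\<not> indep X" "\<not> indep X'"
    and conn: "connected_matroid X (restrict_indep indep X)"
      "connected_matroid X' (restrict_indep indep X')"
    using assms(2-5) unfolding nontrivial_flat_def connected_flat_def by auto
  have sat: "saturated X" "saturated X'"
    using connected_imp_saturated sub conn dep by auto
  obtain x where x: "x \<in> X" "x \<in> X'" using assms(6) by blast
  obtain e where e: "e \<in> ground" "e \<notin> X" "e \<notin> X'" using assms(8) by blast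
  \<comment> \<open>Were \<open>x\<close> a loop, both flats would equal \<open>{x}\<close>.\<close>
  have "{lo x<..hi x} \<noteq> {}"
    using connected_loop[OF conn(1) x(1)] connected_loop[OF conn(2) x(2)] assms(1) by auto
  then obtain j where j: "lo x < j" "j \<le> hi x" by auto
  obtain p where p: "p \<in> {lo e<..hi e}" "p \<notin> nbr X"
    using saturated_flat_memI[OF flat(1) sat(1) e(1)] e(2) by blast
  obtain q where q: "q \<in> {lo e<..hi e}" "q \<notin> nbr X'"
    using saturated_flat_memI[OF flat(2) sat(2) e(1)] e(3) by blast
  have "nbr X \<union> nbr X' = nbr (X \<union> X')" by blast
  also have "\<dots> = {1..r}" using spanning_nbr[OF _ assms(7)] sub by simp
  finally have cover: "nbr X \<union> nbr X' = {1..r}" .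
  have "p \<in> {1..r}" "q \<in> {1..r}" using p q hi_le[OF e(1)] by auto
  then have pq: "p \<in> nbr X'" "q \<in> nbr X" using cover p q by blast+
  have nx: "i \<in> nbr X" "i \<in> nbr X'" if "lo x < i" "i \<le> hi x" for i
    using that x by auto
  \<comment> \<open>Both \<open>p\<close> and \<open>q\<close> lie on the same side of \<open>j\<close>, so one of them lies between \<open>j\<close> and the other.\<close>
  have "x \<in> ground" using x sub by blast
  then consider "lo e \<le> lo x" "hi e \<le> hi x" | "lo x \<le> lo e" "hi x \<le> hi e"
    using comparable e(1) by blast
  then have "p < j \<and> q < j \<or> j < p \<and> j < q"
  proof cases
    case 1
    \<comment> \<open>\<open>p\<close> is at most \<open>hi x\<close> but outside the interval of
      \<open>x\<close>, which lies in \<open>nbr X\<close>; so it is at most \<open>lo x\<close>,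
      below \<open>j\<close>. The other cases are alike.\<close>
    have "p < j" using nx(1)[of p] p j 1 by (cases "p < j") auto
    moreover have "q < j" using nx(2)[of q] q j 1 by (cases "q < j") auto
    ultimately show ?thesis by blast
  next
    case 2
    have "j < p" using nx(1)[of p] p j 2 by (cases "j < p") auto
    moreover have "j < q" using nx(2)[of q] q j 2 by (cases "j < q") auto
    ultimately show ?thesis by blast
  qed
  \<comment> \<open>Whichever of \<open>p\<close> and \<open>q\<close> is nearer to \<open>j\<close>
    is caught in the convex neighbourhood that omits it.\<close>
  then have "p \<le> q \<and> q \<le> j \<or> q \<le> p \<and> p \<le> j \<or> j \<le> p \<and> p \<le> q \<or> j \<le> q \<and> q \<le> p" by linarith
  then show False
    using nbr_convex[OF sub(2) conn(2), of p j q] nbr_convex[OF sub(1) conn(1), of q j p]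
      nbr_convex[OF sub(1) conn(1), of j q p] nbr_convex[OF sub(2) conn(2), of j p q]
      nx[OF j] pq p(2) q(2) by blast
qed

end

section \<open>Lattice paths\<close>

text \<open>After \<open>k\<close> steps, up to its length, the path is at
  \<open>(k - height R k, height R k)\<close>. Paths can thus be compared after equally many steps
  instead of along vertical lines.\<close>

definition height :: "lattice_path \<Rightarrow> nat \<Rightarrow> nat" where
  "height R k = count_list (take k R) North"

lemma count_East_North: "count_list R East + count_list R North = length R"
proof (induction R)
  case (Cons s R)
  then show ?case by (cases s) auto
qed simp

lemma lattice_path_to_length: "lattice_path_to m r R \<Longrightarrow> length R = m + r"
  using count_East_North[of R] by (simp add: lattice_path_to_def)

lemma count_East_take: "k \<le> length R \<Longrightarrow> count_list (take k R) East = k - height R k"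
  using count_East_North[of "take k R"] by (simp add: height_def)

lemma height_le: "height R k \<le> k"
  unfolding height_def by (rule le_trans[OF count_le_length]) simp

lemma height_0 [simp]: "height R 0 = 0"
  by (simp add: height_def)

lemma height_Suc:
  "k < length R \<Longrightarrow> height R (Suc k) = height R k + (if R ! k = North then 1 else 0)"
  by (simp add: height_def take_Suc_conv_app_nth)

lemma height_Suc_bounds: "height R k \<le> height R (Suc k)" "height R (Suc k) \<le> Suc (height R k)"
proof -
  have "height R (Suc k) = height R k \<or> height R (Suc k) = Suc (height R k)"
  proof (cases "k < length R")
    case True
    then show ?thesis by (simp add: height_Suc)
  next
    case False
    then show ?thesis by (simp add: height_def)
  qed
  then show "height R k \<le> height R (Suc k)" "height R (Suc k) \<le> Suc (height R k)" by auto
qed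

lemma height_mono: "k \<le> l \<Longrightarrow> height R k \<le> height R l"
  by (rule lift_Suc_mono_le[of "height R"]) (rule height_Suc_bounds)

lemma East_mono: "k \<le> l \<Longrightarrow> k - height R k \<le> l - height R l"
proof (rule lift_Suc_mono_le[of "\<lambda>k. k - height R k"])
  fix k show "k - height R k \<le> Suc k - height R (Suc k)"
    using height_Suc_bounds(2)[of R k] by linarith
qed

lemma East_Suc: "Suc k - height R (Suc k) \<le> Suc (k - height R k)"
  using height_Suc_bounds(1)[of R k] by linarith

lemma height_end: "lattice_path_to m r R \<Longrightarrow> height R (m + r) = r"
  using lattice_path_to_length[of m r R] by (simp add: height_def lattice_path_to_def)

section \<open>Comparing paths by their heights\<close>

lemma path_points_height: "path_points R = {(k - height R k, height R k) | k. k \<le> length R}"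
  unfolding path_points_def height_def[symmetric]
  by (intro Collect_cong ex_cong1) (auto simp: count_East_take)

text \<open>A discrete intermediate value theorem: increments of at most one skip no value on the
  way up. It finds a point of a path on a given vertical line.\<close>

lemma nat_step_value:
  fixes f :: "nat \<Rightarrow> nat"
  assumes "a \<le> b" "f a \<le> c" "c \<le> f b" "\<And>k. f (Suc k) \<le> Suc (f k)"
  shows "\<exists>k. a \<le> k \<and> k \<le> b \<and> f k = c"
  using assms(1-3)
proof (induction b)
  case 0
  then show ?case by auto
next
  case (Suc b)
  show ?case
  proof (cases "a \<le> b \<and> c \<le> f b")
    case True
    then show ?thesis using Suc by (meson le_SucI)
  next
    case False
    then have "a = Suc b \<or> f b < c" using Suc.prems(1) by linarith
    then have "f (Suc b) = c" using Suc.prems assms(4)[of b] by auto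
    then show ?thesis using Suc.prems(1) by blast
  qed
qed

lemma never_above_iff:
  assumes "lattice_path_to m r R" "lattice_path_to m r Q"
  shows "never_above R Q \<longleftrightarrow> (\<forall>k\<le>m + r. height R k \<le> height Q k)"
proof -
  note len = lattice_path_to_length[OF assms(1)] lattice_path_to_length[OF assms(2)]
  have "height R k \<le> height Q k" if above: "never_above R Q" and k: "k \<le> m + r" for k
  proof -
    obtain l where l: "l \<le> m + r" "k - height R k = l - height Q l" "height R k \<le> height Q l"
      using above k len unfolding never_above_def path_points_height by fastforce
    then have "k \<le> l" using height_le[of R k] height_le[of Q l] by linarith
    \<comment> \<open>In its first \<open>k\<close> steps, \<open>Q\<close> makes no more East steps
      than \<open>R\<close>, hence at least as many North steps.\<close>
    from East_mono[OF this, of Q] show ?thesis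
      using l height_le[of R k] height_le[of Q k] by linarith
  qed
  moreover have "never_above R Q" if le: "\<forall>k\<le>m + r. height R k \<le> height Q k"
    unfolding never_above_def
  proof (clarsimp simp: path_points_height len)
    fix k assume k: "k \<le> m + r"
    \<comment> \<open>Both paths end with equally many East steps, so \<open>Q\<close> meets the
      vertical line in question at some step \<open>l\<close> from \<open>k\<close> on.\<close>
    have "k - height R k \<le> m + r - height Q (m + r)"
      using East_mono[OF k, of R] height_end[OF assms(1)] height_end[OF assms(2)] by simp
    moreover have "k - height Q k \<le> k - height R k" using le k by (simp add: diff_le_mono2)
    ultimately obtain l where l: "k \<le> l" "l \<le> m + r" "l - height Q l = k - height R k"
      using nat_step_value[of k "m + r" "\<lambda>k. k - height Q k" "k - height R k"] k East_Suc[of _ Q]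
      by blast
    then show "\<exists>y'. (\<exists>l. k - height R k = l - height Q l \<and> y' = height Q l \<and> l \<le> m + r) \<and>
        height R k \<le> y'"
      using height_mono[OF l(1), of Q] le k by (metis le_trans)
  qed
  ultimately show ?thesis by blast
qed

lemma never_below_iff:
  assumes "lattice_path_to m r R" "lattice_path_to m r P"
  shows "never_below R P \<longleftrightarrow> (\<forall>k\<le>m + r. height P k \<le> height R k)"
proof -
  note len = lattice_path_to_length[OF assms(1)] lattice_path_to_length[OF assms(2)]
  have "height P k \<le> height R k" if below: "never_below R P" and k: "k \<le> m + r" for k
  proof -
    obtain l where l: "l \<le> m + r" "k - height R k = l - height P l" "height P l \<le> height R k"
      using below k len unfolding never_below_def path_points_height by fastforce
    then have "l \<le> k" using height_le[of R k] height_le[of P l] by linarith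
    from East_mono[OF this, of P] show ?thesis
      using l height_le[of R k] height_le[of P k] by linarith
  qed
  moreover have "never_below R P" if le: "\<forall>k\<le>m + r. height P k \<le> height R k"
    unfolding never_below_def
  proof (clarsimp simp: path_points_height len)
    fix k assume k: "k \<le> m + r"
    \<comment> \<open>Here the vertical line is met at or before step \<open>k\<close>, so the
      search starts at the origin.\<close>
    have "k - height R k \<le> k - height P k" using le k by (simp add: diff_le_mono2)
    then obtain l where l: "l \<le> k" "l - height P l = k - height R k"
      using nat_step_value[of 0 k "\<lambda>k. k - height P k" "k - height R k"] East_Suc[of _ P] by auto
    then show "\<exists>y'. (\<exists>l. k - height R k = l - height P l \<and> y' = height P l \<and> l \<le> m + r) \<and>
        y' \<le> height R k"
      using height_mono[OF l(1), of P] le k by (metis le_trans)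
  qed
  ultimately show ?thesis by blast
qed

section \<open>North sets as intervals\<close>

lemma is_ith_North_step_iff:
  "is_ith_North_step i j R \<longleftrightarrow> 1 \<le> j \<and> j \<le> length R \<and> height R (j - 1) < height R j \<and> height R j = i"
proof (cases "1 \<le> j \<and> j \<le> length R")
  case True
  then have "j - 1 < length R" "Suc (j - 1) = j" by auto
  then have "height R j = height R (j - 1) + (if R ! (j - 1) = North then 1 else 0)"
    using height_Suc[of "j - 1" R] by metis
  then have "height R (j - 1) < height R j \<longleftrightarrow> R ! (j - 1) = North" by simp
  then show ?thesis unfolding is_ith_North_step_def height_def[symmetric] using True by blast
next
  case False
  then show ?thesis unfolding is_ith_North_step_def by blast
qed

lemma path_with_heights:
  fixes f :: "nat \<Rightarrow> nat"
  assumes "f 0 = 0" "f (m + r) = r" "\<And>k. k < m + r \<Longrightarrow> f k \<le> f (Suc k) \<and> f (Suc k) \<le> Suc (f k)"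
  shows "\<exists>R. lattice_path_to m r R \<and> (\<forall>k\<le>m + r. height R k = f k)"
proof -
  define R where "R = map (\<lambda>k. if f (Suc k) = f k then East else North) [0..<m + r]"
  have len: "length R = m + r" by (simp add: R_def)
  have h: "height R k = f k" if "k \<le> m + r" for k
    using that
  proof (induction k)
    case 0
    then show ?case using assms(1) by simp
  next
    case (Suc k)
    then have "f (Suc k) = f k + (if f (Suc k) = f k then 0 else 1)" using assms(3)[of k] by auto
    then show ?case using Suc height_Suc[of k R] by (auto simp: R_def)
  qed
  moreover have "count_list R North = r"
    using h[of "m + r"] len assms(2) by (simp add: height_def)
  then have "lattice_path_to m r R"
    using count_East_North[of R] len by (simp add: lattice_path_to_def)
  ultimately show ?thesis by blast
qed

lemma mem_North_set_iff:
  assumes "lattice_path_to m r P" "lattice_path_to m r Q" "never_above P Q" "j \<in> {1..m + r}"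
  shows "j \<in> North_set m r P Q i \<longleftrightarrow> i \<in> {height P (j - 1)<..height Q j}"
proof
  assume "j \<in> North_set m r P Q i"
  then obtain R where R: "lattice_path_to m r R" "never_above R Q" "never_below R P"
    "is_ith_North_step i j R"
    unfolding North_set_def paths_between_def by blast
  have "height P (j - 1) \<le> height R (j - 1)" "height R j \<le> height Q j"
    using R never_above_iff[OF R(1) assms(2)] never_below_iff[OF R(1) assms(1)] assms(4) by auto
  then show "i \<in> {height P (j - 1)<..height Q j}"
    using R(4) unfolding is_ith_North_step_iff by auto
next
  assume "i \<in> {height P (j - 1)<..height Q j}"
  then have i: "height P (j - 1) < i" "i \<le> height Q j" by auto
  obtain l where l: "j = Suc l" "l < m + r" using assms(4) by (cases j) auto
  \<comment> \<open>The path that stays as close as possible to height \<open>i - 1\<close> before step \<open>j\<close> and to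
    height \<open>i\<close> from then on.\<close>
  define f where "f k = max (height P k) (min (height Q k) (if k < j then i - 1 else i))" for k
  have PQ: "height P k \<le> height Q k" if "k \<le> m + r" for k
    using assms that never_above_iff by blast
  \<comment> \<open>At these two places the bounds \<open>P\<close> and \<open>Q\<close> do not
    interfere, since each path rises by at most one in step \<open>j\<close>.\<close>
  have fl: "f l = i - 1" "f j = i"
    using i height_Suc_bounds[of P l] height_Suc_bounds[of Q l] unfolding f_def l by auto
  have f_step: "f k \<le> f (Suc k) \<and> f (Suc k) \<le> Suc (f k)" if "k < m + r" for k
  proof (cases "k = l")
    case True
    then show ?thesis using fl l by simp
  next
    case False
    \<comment> \<open>Away from step \<open>j\<close> the target height is constant, and maxima and
      minima of functions with increments 0 or 1 have such increments again.\<close>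
    then have "k < j \<longleftrightarrow> Suc k < j" using l by auto
    then show ?thesis
      using height_Suc_bounds[of P k] height_Suc_bounds[of Q k] unfolding f_def by auto
  qed
  have "f (m + r) = r"
    using height_end[OF assms(1)] height_end[OF assms(2)] unfolding f_def by simp
  moreover have "f 0 = 0" by (simp add: f_def)
  ultimately obtain R where R: "lattice_path_to m r R" "\<And>k. k \<le> m + r \<Longrightarrow> height R k = f k"
    using path_with_heights[of f m r] f_step by blast
  have "never_above R Q"
    unfolding never_above_iff[OF R(1) assms(2)] using R(2) PQ by (simp add: f_def)
  moreover have "never_below R P"
    unfolding never_below_iff[OF R(1) assms(1)] using R(2) by (simp add: f_def)
  moreover have "is_ith_North_step i j R"
    unfolding is_ith_North_step_iff lattice_path_to_length[OF R(1)] using R(2) fl l i by simp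
  ultimately show "j \<in> North_set m r P Q i"
    unfolding North_set_def paths_between_def using R(1) by blast
qed

text \<open>Step \<open>j\<close> takes \<open>P\<close> to height \<open>i\<close> for the first
  time. These steps represent the indices when the rank is computed.\<close>

lemma exists_North_step:
  assumes "lattice_path_to m r P" "i \<in> {1..r}"
  shows "\<exists>j\<in>{1..m + r}. height P (j - 1) < i \<and> height P j = i"
proof -
  define j where "j = (LEAST j. i \<le> height P j)"
  have end_ge: "i \<le> height P (m + r)" using height_end[OF assms(1)] assms(2) by simp
  then have ge: "i \<le> height P j" and le: "j \<le> m + r"
    unfolding j_def by (rule LeastI, rule Least_le)
  have j: "j \<noteq> 0" using ge assms(2) by (intro notI) simp
  then have less: "height P (j - 1) < i"
    using not_less_Least[of "j - 1" "\<lambda>j. i \<le> height P j"] unfolding j_def[symmetric] by simp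
  then have "height P j = i"
    using ge j height_Suc_bounds(2)[of P "j - 1"] by simp
  then show ?thesis using less j le by (intro bexI[of _ j]) auto
qed

text \<open>The isomorphism \<open>f\<close> carries the presentation over: by
  \<open>mem_North_set_iff\<close> the indices of \<open>x\<close> lie above the height of
  \<open>P\<close> before step \<open>f x\<close> and go up to that of \<open>Q\<close> after
  it.\<close>

lemma lattice_path_matroid_interval_transversal:
  assumes "matroid ground indep" "lattice_path_matroid ground indep"
  shows "\<exists>lo hi. interval_transversal ground indep lo hi (matroid_rank indep ground)"
proof -
  obtain m r P Q f where P: "lattice_path_to m r P" and Q: "lattice_path_to m r Q"
    and PQ: "never_above P Q" and f: "bij_betw f ground {1..m + r}"
    and iso: "\<And>I. I \<subseteq> ground \<Longrightarrow> indep I \<longleftrightarrow> path_indep m r P Q (f ` I)"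
    using assms(2) unfolding lattice_path_matroid_def matroid_isomorphic_def by blast
  define lo hi where "lo x = height P (f x - 1)" and "hi x = height Q (f x)" for x
  have fx: "f x \<in> {1..m + r}" if "x \<in> ground" for x
    using bij_betwE[OF f] that by blast
  have hi_le: "hi x \<le> r" if "x \<in> ground" for x
    using height_mono[of "f x" "m + r" Q] height_end[OF Q] fx[OF that] by (simp add: hi_def)
  have indep_iff: "indep I \<longleftrightarrow> I \<subseteq> ground \<and> (\<exists>\<phi>. inj_on \<phi> I \<and> (\<forall>x\<in>I. \<phi> x \<in> {lo x<..hi x}))"
    for I
  proof (cases "I \<subseteq> ground")
    case True
    have inj: "inj_on f I" using f True by (meson bij_betw_imp_inj_on inj_on_subset)
    have mem: "i \<in> {1..r} \<and> f x \<in> North_set m r P Q i \<longleftrightarrow> i \<in> {lo x<..hi x}" if "x \<in> I" for x i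
      using mem_North_set_iff[OF P Q PQ fx, of x i] hi_le[of x] that True
      by (auto simp: lo_def hi_def)
    have "path_indep m r P Q (f ` I) \<longleftrightarrow>
        (\<exists>\<psi>. inj_on \<psi> (f ` I) \<and> (\<forall>x\<in>I. \<psi> (f x) \<in> {lo x<..hi x}))"
      unfolding path_indep_def transversal_indep_def using mem fx True by (auto 0 4)
    also have "\<dots> \<longleftrightarrow> (\<exists>\<phi>. inj_on \<phi> I \<and> (\<forall>x\<in>I. \<phi> x \<in> {lo x<..hi x}))"
    proof
      assume "\<exists>\<psi>. inj_on \<psi> (f ` I) \<and> (\<forall>x\<in>I. \<psi> (f x) \<in> {lo x<..hi x})"
      then obtain \<psi> where "inj_on \<psi> (f ` I)" "\<forall>x\<in>I. \<psi> (f x) \<in> {lo x<..hi x}" by blast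
      then show "\<exists>\<phi>. inj_on \<phi> I \<and> (\<forall>x\<in>I. \<phi> x \<in> {lo x<..hi x})"
        using comp_inj_on[OF inj] by (intro exI[of _ "\<psi> \<circ> f"]) simp
    next
      assume "\<exists>\<phi>. inj_on \<phi> I \<and> (\<forall>x\<in>I. \<phi> x \<in> {lo x<..hi x})"
      then obtain \<phi> where \<phi>: "inj_on \<phi> I" "\<forall>x\<in>I. \<phi> x \<in> {lo x<..hi x}" by blast
      have "inj_on (\<phi> \<circ> inv_into I f) (f ` I)"
        using \<phi>(1) inj by (intro comp_inj_on inj_on_inv_into) simp_all
      then show "\<exists>\<psi>. inj_on \<psi> (f ` I) \<and> (\<forall>x\<in>I. \<psi> (f x) \<in> {lo x<..hi x})"
        using \<phi>(2) inj by (intro exI[of _ "\<phi> \<circ> inv_into I f"]) simp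
    qed
    finally show ?thesis using iso[OF True] True by blast
  next
    case False
    then show ?thesis using matroid.indep_ground[OF assms(1)] by blast
  qed
  interpret transversal ground indep "\<lambda>x. {lo x<..hi x}"
    using matroid.finite_ground[OF assms(1)] indep_iff by unfold_locales auto
  \<comment> \<open>The North steps of \<open>P\<close> itself represent all indices. The height of
    \<open>P\<close> is recorded because it makes the choice \<open>g\<close> injective.\<close>
  have "\<forall>i\<in>{1..r}. \<exists>x\<in>ground. lo x < i \<and> i \<le> hi x \<and> height P (f x) = i"
  proof
    fix i assume "i \<in> {1..r}"
    then obtain j where j: "j \<in> {1..m + r}" "height P (j - 1) < i" "height P j = i"
      using exists_North_step[OF P] by blast
    then obtain x where "x \<in> ground" "f x = j" using f by (metis bij_betw_def imageE)
    then show "\<exists>x\<in>ground. lo x < i \<and> i \<le> hi x \<and> height P (f x) = i"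
      using j PQ never_above_iff[OF P Q] by (intro bexI[of _ x]) (auto simp: lo_def hi_def)
  qed
  then obtain g where g: "\<And>i. i \<in> {1..r} \<Longrightarrow>
      g i \<in> ground \<and> lo (g i) < i \<and> i \<le> hi (g i) \<and> height P (f (g i)) = i"
    by metis
  have nbr: "nbr ground = {1..r}"
  proof
    show "nbr ground \<subseteq> {1..r}" using hi_le by fastforce
    show "{1..r} \<subseteq> nbr ground" using g by fastforce
  qed
  have "inj_on g {1..r}" using g by (intro inj_onI) metis
  then have "saturated ground" unfolding saturated_def nbr using g by auto
  then have rank: "matroid_rank indep ground = r" using saturated_rank nbr by simp
  have "interval_transversal ground indep lo hi r"
  proof
    fix x y assume "x \<in> ground" "y \<in> ground"
    show "lo x \<le> lo y \<and> hi x \<le> hi y \<or> lo y \<le> lo x \<and> hi y \<le> hi x"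
      by (cases "f x \<le> f y") (simp_all add: lo_def hi_def height_mono diff_le_mono)
  qed (use hi_le rank in auto)
  then show ?thesis using rank by blast
qed

theorem theorem3p14:
  fixes ground :: "'a set" and indep :: "'a set \<Rightarrow> bool" and r :: nat and X X' :: "'a set"
  assumes "matroid ground indep"
    and "matroid_rank indep ground = r"
    and "X \<noteq> X'"
    and "nontrivial_flat ground indep X" and "connected_flat ground indep X"
    and "nontrivial_flat ground indep X'" and "connected_flat ground indep X'"
    and "X \<inter> X' \<noteq> {}"
    and "matroid_rank indep (X \<union> X') = r"
    and "X \<union> X' \<subset> ground"
  shows "\<not> lattice_path_matroid ground indep"
proof
  assume "lattice_path_matroid ground indep"
  then obtain lo hi where "interval_transversal ground indep lo hi r"
    using lattice_path_matroid_interval_transversal[OF assms(1)] assms(2) by auto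
  then show False
    using interval_transversal.no_two_connected_flats assms(3-10) by metis
qed

end
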